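(* For every positive integer $n$, $\frac{1}{\sqrt2}\le \frac{G_n}{n^{3/2}}\le \frac{75\sqrt{17}}{289}$.
   Context: For a positive integer $n$, $G_n:=\min\left\{\max_{x,y\in\{-1,1\}^n}\left|\sum_{i,j=1}^n a_{ij}x_iy_j\right| : (a_{ij})_{i,j=1}^n\in\{-1,1\}^{n\times n}\right\}$. (Equivalently, in the Gale--Berlekamp switching game on an $n\times n$ array of light bulbs with row and column switches, $G_n$ is the maximal difference between the numbers of on- and off-lights that can be guaranteed from a worst initial configuration.) *)

theory Defs
  imports Complex_Main "HOL-Library.FuncSet"
begin

text \<open>Vectors and matrices of signs are extensional functions on the index set \<open>{1..n}\<close>,
  so each of the two sets below is finite.\<close>

definition sign_vectors :: "nat \<Rightarrow> (nat \<Rightarrow> real) set" where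
  "sign_vectors n = {1..n} \<rightarrow>\<^sub>E {-1, 1}"

definition sign_matrices :: "nat \<Rightarrow> (nat \<Rightarrow> nat \<Rightarrow> real) set" where
  "sign_matrices n = {1..n} \<rightarrow>\<^sub>E sign_vectors n"

definition gale_berlekamp :: "nat \<Rightarrow> real" where
  "gale_berlekamp n =
     (MIN a \<in> sign_matrices n.
        MAX (x, y) \<in> sign_vectors n \<times> sign_vectors n.
          \<bar>\<Sum>i=1..n. \<Sum>j=1..n. a i j * x i * y j\<bar>)"

end

(*
  Choosing x optimally turns the bilinear form into the sum over i of |sum_j a_ij y_j|. For the
  lower bound, average over y: each row contributes E|S_n| for the simple random walk S_n, and
  E|S_n| >= sqrt (n / 2) follows from its closed form in terms of central binomial coefficients.

  For the upper bound, let N >= n be the order of a Hadamard matrix. An n x n submatrix a satisfies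
  |a y|^2 <= n N for all sign vectors y, so G_n <= n sqrt N, which suffices when
  N / n <= (75 sqrt 17 / 289)^2 = 5625 / 4913. Sylvester doubling of the Paley orders
  12, 20, 28, 36, 44, 104 makes consecutive orders close enough for this, except for
  n = 3, 5, 6, 9, 10, 13, 17. For 3, 10, 13, 17 the estimate improves because all row sums have the
  same parity as n.
*)
theory Submission
  imports Defs "HOL-Number_Theory.Euler_Criterion"
begin

section \<open>Hadamard matrices\<close>

definition hadamard_order :: "nat \<Rightarrow> bool" where
  "hadamard_order N \<longleftrightarrow> (\<exists>H :: nat \<Rightarrow> nat \<Rightarrow> int.
     (\<forall>i<N. \<forall>j<N. H i j \<in> {-1, 1}) \<and>
     (\<forall>i<N. \<forall>k<N. i \<noteq> k \<longrightarrow> (\<Sum>j<N. H i j * H k j) = 0))"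

text \<open>Only the cardinality of the index set matters, since rows and columns may be relabelled
  along a bijection. This allows pairs with a Boolean, or residues with a point at infinity, as
  indices.\<close>

lemma hadamard_orderI:
  fixes H :: "'a \<Rightarrow> 'a \<Rightarrow> int"
  assumes fin: "finite I"
    and sign: "\<And>i j. i \<in> I \<Longrightarrow> j \<in> I \<Longrightarrow> H i j \<in> {-1, 1}"
    and orth: "\<And>i k. i \<in> I \<Longrightarrow> k \<in> I \<Longrightarrow> i \<noteq> k \<Longrightarrow> (\<Sum>j\<in>I. H i j * H k j) = 0"
  shows "hadamard_order (card I)"
proof -
  obtain f where f: "bij_betw f {..<card I} I"
    using ex_bij_betw_nat_finite[OF fin] by (auto simp: lessThan_atLeast0)
  have mem: "f i \<in> I" if "i < card I" for i
    using f that by (auto simp: bij_betw_def)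
  have inj: "f i \<noteq> f k" if "i < card I" "k < card I" "i \<noteq> k" for i k
    using f that by (auto simp: bij_betw_def inj_on_def)
  have "(\<Sum>j<card I. H (f i) (f j) * H (f k) (f j)) = (\<Sum>j\<in>I. H (f i) j * H (f k) j)" for i k
    by (rule sum.reindex_bij_betw[OF f])
  then show ?thesis
    unfolding hadamard_order_def
    by (intro exI[of _ "\<lambda>i j. H (f i) (f j)"] conjI allI impI)
      (simp_all only: sign orth mem inj not_False_eq_True)
qed

section \<open>Sylvester doubling\<close>

lemma hadamard_order_1: "hadamard_order 1"
  unfolding hadamard_order_def by (intro exI[of _ "\<lambda>_ _. 1"]) auto

text \<open>The Kronecker product with the 2 x 2 Hadamard matrix \<open>K\<close> works because
  inner products of its rows factor.\<close>

lemma hadamard_order_double: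
  assumes "hadamard_order N"
  shows "hadamard_order (2 * N)"
proof -
  obtain H :: "nat \<Rightarrow> nat \<Rightarrow> int"
    where sign: "\<And>i j. i < N \<Longrightarrow> j < N \<Longrightarrow> H i j \<in> {-1, 1}"
      and orth: "\<And>i k. i < N \<Longrightarrow> k < N \<Longrightarrow> i \<noteq> k \<Longrightarrow> (\<Sum>j<N. H i j * H k j) = 0"
    using assms unfolding hadamard_order_def by blast
  define K :: "bool \<Rightarrow> bool \<Rightarrow> int" where "K s t = (if s \<and> t then -1 else 1)" for s t
  define H' where "H' = (\<lambda>(i, s) (j, t). H i j * K s t)"
  have "hadamard_order (card ({..<N} \<times> (UNIV :: bool set)))"
  proof (rule hadamard_orderI[where H = H'])
    fix a b :: "nat \<times> bool"
    assume "a \<in> {..<N} \<times> UNIV" "b \<in> {..<N} \<times> UNIV"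
    then show "H' a b \<in> {-1, 1}"
      using sign[of "fst a" "fst b"] by (auto simp: H'_def K_def split: prod.splits)
  next
    fix a b :: "nat \<times> bool"
    assume ab: "a \<in> {..<N} \<times> UNIV" "b \<in> {..<N} \<times> UNIV" "a \<noteq> b"
    obtain i s k u where eq: "a = (i, s)" "b = (k, u)" by fastforce
    have "(\<Sum>c\<in>{..<N} \<times> UNIV. H' a c * H' b c)
        = (\<Sum>j<N. \<Sum>t\<in>UNIV. (H i j * H k j) * (K s t * K u t))"
      by (simp add: sum.cartesian_product H'_def eq algebra_simps split_def)
    also have "\<dots> = (\<Sum>j<N. H i j * H k j) * (\<Sum>t\<in>UNIV. K s t * K u t)"
      by (simp only: sum_product)
    \<comment> \<open>Distinct pairs differ in a component: if \<open>i \<noteq> k\<close> the first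
      factor vanishes, otherwise \<open>s \<noteq> u\<close> and the second one does.\<close>
    also have "\<dots> = 0"
      using ab orth[of i k] by (cases "i = k") (auto simp: eq K_def UNIV_bool)
    finally show "(\<Sum>c\<in>{..<N} \<times> UNIV. H' a c * H' b c) = 0" .
  qed auto
  then show ?thesis by (simp add: card_cartesian_product mult.commute)
qed

lemma hadamard_order_power_mult:
  assumes "hadamard_order N"
  shows "hadamard_order (2 ^ k * N)"
proof (induction k)
  case (Suc k)
  then show ?case using hadamard_order_double[OF Suc] by (simp add: mult.assoc)
qed (use assms in simp)

section \<open>Hadamard matrices from conference matrices\<close>

definition conference :: "'a set \<Rightarrow> ('a \<Rightarrow> 'a \<Rightarrow> int) \<Rightarrow> bool" where
  "conference I C \<longleftrightarrow> finite I \<and>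
     (\<forall>i\<in>I. C i i = 0) \<and> (\<forall>i\<in>I. \<forall>j\<in>I. i \<noteq> j \<longrightarrow> C i j \<in> {-1, 1}) \<and>
     (\<forall>i\<in>I. \<forall>k\<in>I. i \<noteq> k \<longrightarrow> (\<Sum>j\<in>I. C i j * C k j) = 0)"

text \<open>Adding the identity fills the zero diagonal. The cross terms in the product of rows
  \<open>i\<close> and \<open>k\<close> are \<open>C i k + C k i\<close>, which cancel by
  skewness.\<close>

lemma hadamard_order_skew_conference:
  assumes C: "conference I C" and skew: "\<And>i j. i \<in> I \<Longrightarrow> j \<in> I \<Longrightarrow> C j i = - C i j"
  shows "hadamard_order (card I)"
proof -
  define H where "H i j = C i j + of_bool (i = j)" for i j
  have fin: "finite I" using C by (simp add: conference_def)
  have sign: "H i j \<in> {-1, 1}" if "i \<in> I" "j \<in> I" for i j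
    using C that by (cases "i = j") (simp_all add: conference_def H_def)
  have "(\<Sum>j\<in>I. H i j * H k j) = 0" if ik: "i \<in> I" "k \<in> I" "i \<noteq> k" for i k
  proof -
    have "(\<Sum>j\<in>I. H i j * H k j) = (\<Sum>j\<in>I. C i j * C k j + (if j = k then C i j else 0)
        + (if j = i then C k j else 0))"
      using ik by (intro sum.cong) (auto simp: H_def algebra_simps)
    also have "\<dots> = 0 + C i k + C k i"
      using C ik fin by (simp add: sum.distrib conference_def)
    finally show ?thesis using skew[OF ik(1,2)] by simp
  qed
  with fin sign show ?thesis by (rule hadamard_orderI)
qed

text \<open>For symmetric \<open>C\<close> the identity alone would leave the cross terms, so the
  matrix is C (x) K + I (x) L with two 2 x 2 Hadamard matrices. They are chosen so that K L^T is
  skew, and the cross terms again cancel.\<close>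

lemma hadamard_order_symmetric_conference:
  assumes C: "conference I C" and sym: "\<And>i j. i \<in> I \<Longrightarrow> j \<in> I \<Longrightarrow> C j i = C i j"
  shows "hadamard_order (2 * card I)"
proof -
  define K :: "bool \<Rightarrow> bool \<Rightarrow> int" where "K s t = (if s \<and> t then -1 else 1)" for s t
  define L :: "bool \<Rightarrow> bool \<Rightarrow> int" where "L s t = (if s \<or> t then -1 else 1)" for s t
  define H where "H = (\<lambda>(i, s) (j, t). C i j * K s t + of_bool (i = j) * L s t)"
  have fin: "finite I" using C by (simp add: conference_def)
  have "hadamard_order (card (I \<times> (UNIV :: bool set)))"
  proof (rule hadamard_orderI[where H = H])
    show "H a b \<in> {-1, 1}" if "a \<in> I \<times> UNIV" "b \<in> I \<times> UNIV" for a b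
      using C that by (cases "fst a = fst b") (auto simp: H_def K_def L_def conference_def split: prod.splits)
  next
    fix a b assume ab: "a \<in> I \<times> (UNIV :: bool set)" "b \<in> I \<times> (UNIV :: bool set)" "a \<noteq> b"
    obtain i s k u where eq: "a = (i, s)" "b = (k, u)" by fastforce
    have ik: "i \<in> I" "k \<in> I" using ab eq by auto
    let ?KK = "\<Sum>t\<in>UNIV. K s t * K u t" and ?KL = "\<Sum>t\<in>UNIV. K s t * L u t"
    let ?LK = "\<Sum>t\<in>UNIV. L s t * K u t" and ?LL = "\<Sum>t\<in>UNIV. L s t * L u t"
    have "(\<Sum>c\<in>I \<times> UNIV. H a c * H b c) = (\<Sum>j\<in>I. \<Sum>t\<in>UNIV. H a (j, t) * H b (j, t))"
      by (simp add: sum.cartesian_product)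
    also have "\<dots> = (\<Sum>j\<in>I. C i j * C k j * ?KK + (if j = k then C i j * ?KL else 0)
        + (if j = i then C k j * ?LK else 0) + (if j = i then of_bool (i = k) * ?LL else 0))"
      using ik by (intro sum.cong) (auto simp: H_def eq UNIV_bool algebra_simps)
    also have "\<dots> = (\<Sum>j\<in>I. C i j * C k j) * ?KK + C i k * ?KL + C k i * ?LK + of_bool (i = k) * ?LL"
      using ik fin by (simp add: sum.distrib sum_distrib_right)
    also have "\<dots> = 0"
    proof (cases "i = k")
      case True
      then show ?thesis
        using C ik ab eq by (auto simp: conference_def K_def L_def UNIV_bool)
    next
      case False
      moreover have "?KL = - ?LK" by (auto simp: K_def L_def UNIV_bool)
      ultimately show ?thesis
        using C ik sym[OF ik] by (simp add: conference_def)
    qed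
    finally show "(\<Sum>c\<in>I \<times> UNIV. H a c * H b c) = 0" .
  qed (use fin in auto)
  then show ?thesis by (simp add: card_cartesian_product mult.commute)
qed

section \<open>The quadratic character and Paley's conference matrices\<close>

context
  fixes p :: nat
  assumes p: "prime p" "2 < p"
begin

lemma Legendre_values: "Legendre a (int p) \<in> {-1, 0, 1}"
  by (simp add: Legendre_def)

lemma Legendre_eq_0_iff: "Legendre a (int p) = 0 \<longleftrightarrow> int p dvd a"
  by (simp add: Legendre_def cong_0_iff)

lemma Legendre_cong:
  assumes "[a = b] (mod int p)"
  shows "Legendre a (int p) = Legendre b (int p)"
proof -
  have "[a = 0] (mod int p) \<longleftrightarrow> [b = 0] (mod int p)"
    using assms by (meson cong_sym cong_trans)
  moreover have "QuadRes (int p) a \<longleftrightarrow> QuadRes (int p) b"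
    unfolding QuadRes_def using assms by (meson cong_sym cong_trans)
  ultimately show ?thesis by (simp add: Legendre_def)
qed

text \<open>As \<open>p > 2\<close>, the numbers -1, 0, 1 are distinct modulo \<open>p\<close>. This
  turns the congruences of Euler's criterion into equations between Legendre symbols.\<close>

lemma small_cong_imp_eq:
  assumes "[a = b] (mod int p)" "a \<in> {-1, 0, 1}" "b \<in> {-1, 0, 1}"
  shows "a = b"
proof (rule ccontr)
  assume "a \<noteq> b"
  have "int p dvd a - b" using assms(1) by (simp add: cong_iff_dvd_diff)
  then have "\<bar>int p\<bar> \<le> \<bar>a - b\<bar>" using \<open>a \<noteq> b\<close> by (intro dvd_imp_le_int) auto
  then show False using assms p by auto
qed

lemma Legendre_mult: "Legendre (a * b) (int p) = Legendre a (int p) * Legendre b (int p)"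
proof (rule small_cong_imp_eq)
  have "[Legendre a (int p) * Legendre b (int p) = a ^ ((p - 1) div 2) * b ^ ((p - 1) div 2)] (mod int p)"
    using euler_criterion[OF p] by (intro cong_mult)
  also have "a ^ ((p - 1) div 2) * b ^ ((p - 1) div 2) = (a * b) ^ ((p - 1) div 2)"
    by (simp add: power_mult_distrib)
  finally show "[Legendre (a * b) (int p) = Legendre a (int p) * Legendre b (int p)] (mod int p)"
    using euler_criterion[OF p, of "a * b"] by (meson cong_sym cong_trans)
qed (use Legendre_values[of a] Legendre_values[of b] Legendre_values[of "a * b"] in auto)

lemma Legendre_minus_1: "Legendre (-1) (int p) = (-1) ^ ((p - 1) div 2)"
proof (rule small_cong_imp_eq[OF euler_criterion[OF p]])
  show "(-1) ^ ((p - 1) div 2) \<in> {-1, 0, 1 :: int}"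
    using minus_one_power_iff[of "(p - 1) div 2", where 'a = int] by auto
qed (rule Legendre_values)

text \<open>An affine map with invertible slope permutes the residues.\<close>

lemma sum_residues_affine:
  fixes f :: "int \<Rightarrow> int"
  assumes f: "\<And>x. f (x mod int p) = f x" and c: "\<not> int p dvd c"
  shows "(\<Sum>x\<in>{0..<int p}. f (c * x + d)) = (\<Sum>x\<in>{0..<int p}. f x)"
proof -
  define h where "h x = (c * x + d) mod int p" for x
  have "inj_on h {0..<int p}"
  proof (rule inj_onI)
    fix x y assume xy: "x \<in> {0..<int p}" "y \<in> {0..<int p}" and "h x = h y"
    then have "int p dvd c * x + d - (c * y + d)"
      unfolding h_def by (simp add: mod_eq_dvd_iff)
    then have "int p dvd c * (x - y)" by (simp add: algebra_simps)
    then have "int p dvd x - y" using c p by (simp add: prime_dvd_mult_iff)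
    then have "x mod int p = y mod int p" by (simp add: mod_eq_dvd_iff)
    then show "x = y" using xy by simp
  qed
  moreover have "h ` {0..<int p} \<subseteq> {0..<int p}" using p by (auto simp: h_def)
  ultimately have "bij_betw h {0..<int p} {0..<int p}"
    by (simp add: bij_betw_def endo_inj_surj)
  then have "(\<Sum>x\<in>{0..<int p}. f (h x)) = (\<Sum>x\<in>{0..<int p}. f x)"
    by (rule sum.reindex_bij_betw)
  then show ?thesis by (simp add: h_def f)
qed

lemma Legendre_mod: "Legendre (a mod int p) (int p) = Legendre a (int p)"
  by (rule Legendre_cong) simp

text \<open>Otherwise squaring would map the residues onto themselves and hence be injective,
  although 1 and \<open>p - 1\<close> have the same square.\<close>

lemma exists_nonresidue: "\<exists>g. Legendre g (int p) = -1"
proof (rule ccontr)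
  assume none: "\<nexists>g. Legendre g (int p) = -1"
  define h where "h x = x\<^sup>2 mod int p" for x
  have "{0..<int p} \<subseteq> h ` {0..<int p}"
  proof
    fix a assume a: "a \<in> {0..<int p}"
    show "a \<in> h ` {0..<int p}"
    proof (cases "a = 0")
      case True
      then show ?thesis using p by (auto simp: h_def intro!: image_eqI[of _ _ 0])
    next
      case False
      have "\<not> [a = 0] (mod int p)" using False a by (simp add: cong_def)
      then have "QuadRes (int p) a" using none unfolding Legendre_def by metis
      then obtain y where "[y\<^sup>2 = a] (mod int p)" by (auto simp: QuadRes_def)
      then have "h (y mod int p) = a" using a by (simp add: h_def cong_def power_mod)
      then show ?thesis using p by (intro image_eqI[of _ _ "y mod int p"]) auto
    qed
  qed
  moreover have "h ` {0..<int p} \<subseteq> {0..<int p}" using p by (auto simp: h_def)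
  ultimately have "inj_on h {0..<int p}"
    by (metis eq_card_imp_inj_on finite_atLeastLessThan_int subset_antisym)
  moreover have "h 1 = h (int p - 1)"
  proof -
    have "(int p - 1)\<^sup>2 - 1 = int p * (int p - 2)" by (simp add: power2_eq_square algebra_simps)
    then have "int p dvd (int p - 1)\<^sup>2 - 1\<^sup>2" by simp
    then show ?thesis unfolding h_def by (metis mod_eq_dvd_iff)
  qed
  ultimately show False using p by (auto dest: inj_onD)
qed

text \<open>Multiplying all residues by a nonresidue permutes them and negates the sum.\<close>

lemma sum_Legendre: "(\<Sum>x\<in>{0..<int p}. Legendre x (int p)) = 0"
proof -
  obtain g where g: "Legendre g (int p) = -1" using exists_nonresidue by blast
  then have "\<not> int p dvd g" using Legendre_eq_0_iff[of g] by auto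
  from sum_residues_affine[of "\<lambda>x. Legendre x (int p)", OF Legendre_mod this, of 0]
  show ?thesis by (simp add: Legendre_mult g sum_negf)
qed

lemma sum_Legendre_shift: "(\<Sum>x\<in>{0..<int p}. Legendre (x + d) (int p)) = 0"
  using sum_residues_affine[of "\<lambda>x. Legendre x (int p)" 1 d] Legendre_mod sum_Legendre p by simp

lemma Legendre_square: "Legendre a (int p) * Legendre a (int p) = 1" if "\<not> int p dvd a"
  using Legendre_eq_0_iff[of a] Legendre_values[of a] that by auto

lemma not_dvd_less: "\<not> int p dvd a" if "a \<noteq> 0" "\<bar>a\<bar> < int p"
  using that dvd_imp_le_int[of a "int p"] by auto

text \<open>For \<open>c\<close> prime to \<open>p\<close> the sum does not depend on \<open>c\<close>, as \<open>x \<mapsto> c * x\<close> shows; its value then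
  follows because the sums over all residues \<open>c\<close> add up to \<open>0\<close>.\<close>

lemma sum_Legendre_mult_shift:
  assumes c: "\<not> int p dvd c"
  shows "(\<Sum>x\<in>{0..<int p}. Legendre x (int p) * Legendre (x + c) (int p)) = -1"
proof -
  define S where "S c = (\<Sum>x\<in>{0..<int p}. Legendre x (int p) * Legendre (x + c) (int p))" for c
  have scale: "S c = S 1" if c: "\<not> int p dvd c" for c
  proof -
    have per: "Legendre (x mod int p) (int p) * Legendre (x mod int p + c) (int p)
        = Legendre x (int p) * Legendre (x + c) (int p)" for x
      by (metis Legendre_mod mod_add_left_eq)
    have "Legendre (c * x) (int p) * Legendre (c * x + c) (int p)
        = Legendre x (int p) * Legendre (x + 1) (int p)" for x
    proof -
      have "c * x + c = c * (x + 1)" by (simp add: algebra_simps)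
      then have "Legendre (c * x) (int p) * Legendre (c * x + c) (int p)
          = (Legendre c (int p) * Legendre c (int p)) * (Legendre x (int p) * Legendre (x + 1) (int p))"
        by (simp only: Legendre_mult mult_ac)
      then show ?thesis by (simp add: Legendre_square[OF c])
    qed
    then show ?thesis
      using sum_residues_affine[of "\<lambda>x. Legendre x (int p) * Legendre (x + c) (int p)", OF per c, of 0]
      by (simp add: S_def)
  qed
  have ndvd: "\<not> int p dvd x" if "x \<in> {1..<int p}" for x
    using that by (intro not_dvd_less) auto
  have split: "{0..<int p} = insert 0 {1..<int p}" using p by auto
  have "(\<Sum>c\<in>{0..<int p}. S c)
      = (\<Sum>x\<in>{0..<int p}. Legendre x (int p) * (\<Sum>c\<in>{0..<int p}. Legendre (c + x) (int p)))"
    unfolding S_def sum_distrib_left by (subst sum.swap) (simp add: add.commute)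
  also have "\<dots> = 0" by (simp add: sum_Legendre_shift)
  finally have "S 0 + (\<Sum>c\<in>{1..<int p}. S c) = 0" unfolding split by simp
  moreover have "(\<Sum>c\<in>{1..<int p}. S c) = (int p - 1) * S 1"
    using p sum.cong[OF refl scale[OF ndvd], of "{1..<int p}"] by simp
  moreover have "S 0 = int p - 1"
    using p by (simp add: S_def split Legendre_square ndvd Legendre_eq_0_iff)
  ultimately have "(int p - 1) * (1 + S 1) = 0" by (simp add: algebra_simps)
  then show ?thesis using scale[OF c] p by (simp add: S_def)
qed

text \<open>The index \<open>-1\<close> plays the role of the point at infinity. Its column carries the value of the
  quadratic character at \<open>-1\<close> so that transposing multiplies the whole matrix by that value.\<close>

definition paley_conference :: "int \<Rightarrow> int \<Rightarrow> int" where
  "paley_conference i j =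
     (if i = -1 then of_bool (j \<noteq> -1)
      else if j = -1 then Legendre (-1) (int p) else Legendre (j - i) (int p))"

lemma paley_conference_transpose:
  assumes "i \<in> insert (-1) {0..<int p}" "j \<in> insert (-1) {0..<int p}"
  shows "paley_conference j i = Legendre (-1) (int p) * paley_conference i j"
proof -
  have "Legendre (i - j) (int p) = Legendre (-1) (int p) * Legendre (j - i) (int p)"
    using Legendre_mult[of "-1" "j - i"] by simp
  moreover have "Legendre (-1) (int p) * Legendre (-1) (int p) = 1"
    using p by (intro Legendre_square not_dvd_less) auto
  ultimately show ?thesis using assms by (auto simp: paley_conference_def)
qed

text \<open>For two rows indexed by residues, the residue columns contribute -1 by
  \<open>sum_Legendre_mult_shift\<close>, and the column at infinity contributes the square of the
  character at -1, which is 1. Against the row at infinity the product is a complete character sum,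
  hence 0.\<close>

lemma conference_paley: "conference (insert (-1) {0..<int p}) paley_conference"
proof -
  let ?I = "insert (-1) {0..<int p}"
  have m1: "Legendre (-1) (int p) * Legendre (-1) (int p) = 1"
    using p by (intro Legendre_square not_dvd_less) auto
  have sum_I: "(\<Sum>j\<in>?I. f j) = f (-1) + (\<Sum>j\<in>{0..<int p}. f j)" for f :: "int \<Rightarrow> int"
    by simp
  have "paley_conference i i = 0" for i
    by (simp add: paley_conference_def Legendre_eq_0_iff)
  moreover have "paley_conference i j \<in> {-1, 1}" if "i \<in> ?I" "j \<in> ?I" "i \<noteq> j" for i j
  proof -
    have "paley_conference i j \<noteq> 0"
      using that p by (auto simp: paley_conference_def Legendre_eq_0_iff not_dvd_less)
    moreover have "paley_conference i j \<in> {-1, 0, 1}"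
      using Legendre_values by (simp add: paley_conference_def)
    ultimately show ?thesis by blast
  qed
  moreover have "(\<Sum>j\<in>?I. paley_conference i j * paley_conference k j) = 0"
    if "i \<in> ?I" "k \<in> ?I" "i \<noteq> k" for i k
  proof -
    have border: "(\<Sum>j\<in>{0..<int p}. paley_conference (-1) j * paley_conference k j) = 0" if "k \<noteq> -1" for k
      using that sum_Legendre_shift[of "-k"] by (simp add: paley_conference_def)
    consider "i = -1" | "k = -1" | "i \<noteq> -1" "k \<noteq> -1" by blast
    then show ?thesis
    proof cases
      case 1
      then show ?thesis using border[of k] that unfolding sum_I by (simp add: paley_conference_def)
    next
      case 2
      then show ?thesis using border[of i] that unfolding sum_I by (simp add: paley_conference_def mult.commute)
    next
      case 3
      let ?f = "\<lambda>x. Legendre x (int p) * Legendre (x + (i - k)) (int p)"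
      have "(\<Sum>j\<in>{0..<int p}. paley_conference i j * paley_conference k j)
          = (\<Sum>j\<in>{0..<int p}. ?f (1 * j + (- i)))"
        using 3 by (intro sum.cong) (auto simp: paley_conference_def)
      also have "\<dots> = (\<Sum>x\<in>{0..<int p}. ?f x)"
        using p by (intro sum_residues_affine) (simp_all add: Legendre_mod, metis Legendre_mod mod_add_left_eq)
      also have "\<dots> = -1"
        using 3 that by (intro sum_Legendre_mult_shift not_dvd_less) auto
      finally show ?thesis using 3 m1 unfolding sum_I by (simp add: paley_conference_def)
    qed
  qed
  ultimately show ?thesis by (simp add: conference_def)
qed

text \<open>Here -1 is a nonresidue by Euler's criterion, so transposition negates the Paley matrix
  and the skew construction applies.\<close>

theorem hadamard_order_paley_I:
  assumes "p mod 4 = 3"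
  shows "hadamard_order (p + 1)"
proof -
  have "odd ((p - 1) div 2)" using assms by presburger
  then have "Legendre (-1) (int p) = -1" by (simp add: Legendre_minus_1)
  then have "paley_conference j i = - paley_conference i j"
    if "i \<in> insert (-1) {0..<int p}" "j \<in> insert (-1) {0..<int p}" for i j
    using paley_conference_transpose[OF that] by simp
  from hadamard_order_skew_conference[OF conference_paley this]
  show ?thesis by simp
qed

text \<open>Here -1 is a residue, so the Paley matrix is symmetric and the order doubles.\<close>

theorem hadamard_order_paley_II:
  assumes "p mod 4 = 1"
  shows "hadamard_order (2 * (p + 1))"
proof -
  have "even ((p - 1) div 2)" using assms by presburger
  then have "Legendre (-1) (int p) = 1" by (simp add: Legendre_minus_1)
  then have "paley_conference j i = paley_conference i j"
    if "i \<in> insert (-1) {0..<int p}" "j \<in> insert (-1) {0..<int p}" for i j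
    using paley_conference_transpose[OF that] by simp
  from hadamard_order_symmetric_conference[OF conference_paley this]
  show ?thesis by simp
qed

end

section \<open>The orders that the upper bound uses\<close>

lemma hadamard_orders:
  "hadamard_order (2 ^ k * 12)" "hadamard_order (2 ^ k * 20)" "hadamard_order (2 ^ k * 28)"
  "hadamard_order (2 ^ k * 36)" "hadamard_order (2 ^ k * 44)" "hadamard_order (2 ^ k * 104)"
  "hadamard_order (2 ^ k)"
proof -
  \<comment> \<open>The primes 11, 19, 43, 103 are 3 modulo 4 and give 12, 20, 44, 104; the primes
    13, 17 are 1 modulo 4 and give 28, 36.\<close>
  have "prime (11::nat)" "prime (19::nat)" "prime (43::nat)" "prime (103::nat)"
    "prime (13::nat)" "prime (17::nat)"
    by simp_all
  from this[THEN hadamard_order_paley_I] this[THEN hadamard_order_paley_II]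
  have "hadamard_order 12" "hadamard_order 20" "hadamard_order 28" "hadamard_order 36"
    "hadamard_order 44" "hadamard_order 104"
    by simp_all
  then show "hadamard_order (2 ^ k * 12)" "hadamard_order (2 ^ k * 20)" "hadamard_order (2 ^ k * 28)"
    "hadamard_order (2 ^ k * 36)" "hadamard_order (2 ^ k * 44)" "hadamard_order (2 ^ k * 104)"
    by (auto intro: hadamard_order_power_mult)
  show "hadamard_order (2 ^ k)"
    using hadamard_order_power_mult[OF hadamard_order_1, of k] by simp
qed

section \<open>The lower bound\<close>

lemma finite_sign_vectors [simp]: "finite (sign_vectors n)"
  by (simp add: sign_vectors_def finite_PiE)

lemma finite_sign_matrices [simp]: "finite (sign_matrices n)"
  by (simp add: sign_matrices_def finite_PiE)

lemma sign_vectors_nth: "x \<in> sign_vectors n \<Longrightarrow> i \<in> {1..n} \<Longrightarrow> x i \<in> {-1, 1}"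
  unfolding sign_vectors_def by (rule PiE_mem)

lemma sign_matrices_nth: "a \<in> sign_matrices n \<Longrightarrow> i \<in> {1..n} \<Longrightarrow> a i \<in> sign_vectors n"
  unfolding sign_matrices_def by (rule PiE_mem)

lemma restrict_sign_vectors:
  "(\<And>i. i \<in> {1..n} \<Longrightarrow> f i \<in> {-1, 1}) \<Longrightarrow> restrict f {1..n} \<in> sign_vectors n"
  unfolding sign_vectors_def by (rule restrict_PiE_iff[THEN iffD2]) blast

lemma restrict_sign_matrices:
  "(\<And>i j. i \<in> {1..n} \<Longrightarrow> j \<in> {1..n} \<Longrightarrow> f i j \<in> {-1, 1}) \<Longrightarrow>
    (\<lambda>i\<in>{1..n}. \<lambda>j\<in>{1..n}. f i j) \<in> sign_matrices n"
  unfolding sign_matrices_def by (rule restrict_PiE_iff[THEN iffD2]) (blast intro: restrict_sign_vectors)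

lemma bilinear_sum_eq:
  fixes a :: "nat \<Rightarrow> nat \<Rightarrow> real"
  shows "(\<Sum>i=1..n. \<Sum>j=1..n. a i j * x i * y j) = (\<Sum>i=1..n. x i * (\<Sum>j=1..n. a i j * y j))"
  by (simp add: sum_distrib_left mult_ac)

text \<open>This eliminates \<open>x\<close>: by the triangle inequality no choice of row signs
  beats the sum of the absolute row sums.\<close>

lemma gale_berlekamp_le:
  assumes a: "a \<in> sign_matrices n"
    and le: "\<And>y. y \<in> sign_vectors n \<Longrightarrow> (\<Sum>i=1..n. \<bar>\<Sum>j=1..n. a i j * y j\<bar>) \<le> c"
  shows "gale_berlekamp n \<le> c"
proof -
  let ?V = "sign_vectors n \<times> sign_vectors n"
  let ?f = "\<lambda>a (x, y). \<bar>\<Sum>i=1..n. \<Sum>j=1..n. a i j * x i * y j\<bar>"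
  have bound: "?f a (x, y) \<le> c" if "x \<in> sign_vectors n" "y \<in> sign_vectors n" for x y
  proof -
    have "?f a (x, y) \<le> (\<Sum>i=1..n. \<bar>x i * (\<Sum>j=1..n. a i j * y j)\<bar>)"
      unfolding bilinear_sum_eq prod.case by (rule sum_abs)
    also have "\<dots> = (\<Sum>i=1..n. \<bar>\<Sum>j=1..n. a i j * y j\<bar>)"
      using sign_vectors_nth[OF that(1)] by (intro sum.cong refl) (force simp: abs_mult)
    also have "\<dots> \<le> c" using le that(2) .
    finally show ?thesis .
  qed
  have ne: "sign_vectors n \<noteq> {}" using restrict_sign_vectors[of n "\<lambda>_. 1"] by auto
  have "gale_berlekamp n \<le> Max (?f a ` ?V)"
    unfolding gale_berlekamp_def using a by (intro Min_le) auto
  also have "\<dots> \<le> c"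
    using bound ne by (intro Max.boundedI) auto
  finally show ?thesis .
qed

text \<open>The bound by absolute row sums is attained when \<open>x i\<close> is the sign of the
  i-th row sum, with 1 for a zero sum.\<close>

lemma le_gale_berlekamp:
  assumes ex: "\<And>a. a \<in> sign_matrices n \<Longrightarrow>
    \<exists>y\<in>sign_vectors n. c \<le> (\<Sum>i=1..n. \<bar>\<Sum>j=1..n. a i j * y j\<bar>)"
  shows "c \<le> gale_berlekamp n"
proof -
  let ?V = "sign_vectors n \<times> sign_vectors n"
  let ?f = "\<lambda>a (x, y). \<bar>\<Sum>i=1..n. \<Sum>j=1..n. a i j * x i * y j\<bar>"
  have "c \<le> Max (?f a ` ?V)" if "a \<in> sign_matrices n" for a
  proof -
    from ex[OF that] obtain y where y: "y \<in> sign_vectors n"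
      and le: "c \<le> (\<Sum>i=1..n. \<bar>\<Sum>j=1..n. a i j * y j\<bar>)"
      by blast
    define x where
      "x = (\<lambda>i\<in>{1..n}. if 0 \<le> (\<Sum>j=1..n. a i j * y j) then 1 else -1 :: real)"
    have x: "x \<in> sign_vectors n" unfolding x_def by (rule restrict_sign_vectors) auto
    note le
    also have "(\<Sum>i=1..n. \<bar>\<Sum>j=1..n. a i j * y j\<bar>) = (\<Sum>i=1..n. x i * (\<Sum>j=1..n. a i j * y j))"
      by (intro sum.cong) (auto simp: x_def)
    also have "\<dots> \<le> ?f a (x, y)" unfolding bilinear_sum_eq prod.case by (rule abs_ge_self)
    also have "\<dots> \<le> Max (?f a ` ?V)" using x y by (intro Max_ge) auto
    finally show ?thesis .
  qed
  moreover have "sign_matrices n \<noteq> {}" using restrict_sign_matrices[of n "\<lambda>_ _. 1"] by auto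
  ultimately show ?thesis
    unfolding gale_berlekamp_def by (intro Min.boundedI) auto
qed

section \<open>The mean distance of the simple random walk\<close>

text \<open>Pascal's rule, read as one more step of the walk: after \<open>k\<close> downward steps
  out of \<open>n\<close> the position is \<open>n - 2 * k\<close>, and it then moves by 1 or
  -1.\<close>

lemma binomial_sum_Suc:
  fixes g :: "real \<Rightarrow> real"
  shows "(\<Sum>k\<le>Suc n. real (Suc n choose k) * g (real (Suc n) - 2 * real k))
    = (\<Sum>k\<le>n. real (n choose k) * (g (real n - 2 * real k + 1) + g (real n - 2 * real k - 1)))"
proof -
  let ?h = "\<lambda>k. g (real (Suc n) - 2 * real k)"
  have "(\<Sum>k\<le>Suc n. real (Suc n choose k) * ?h k)
      = ?h 0 + (\<Sum>k\<le>n. real (n choose Suc k) * ?h (Suc k)) + (\<Sum>k\<le>n. real (n choose k) * ?h (Suc k))"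
    unfolding sum.atMost_Suc_shift by (simp add: algebra_simps sum.distrib)
  also have "?h 0 + (\<Sum>k\<le>n. real (n choose Suc k) * ?h (Suc k)) = (\<Sum>k\<le>Suc n. real (n choose k) * ?h k)"
    unfolding sum.atMost_Suc_shift by simp
  also have "\<dots> = (\<Sum>k\<le>n. real (n choose k) * ?h k)" by simp
  finally show ?thesis
    by (simp add: algebra_simps sum.distrib)
qed

text \<open>The signs \<open>a i\<close> merely permute the values of each \<open>x i\<close>, so
  every row behaves like the plain random walk. Splitting off a coordinate replaces \<open>g\<close>
  by \<open>\<lambda>t. g (t + 1) + g (t - 1)\<close>, which is why \<open>g\<close> varies in the
  induction.\<close>

lemma sum_signs:
  fixes g :: "real \<Rightarrow> real" and a :: "'a \<Rightarrow> real"
  assumes "finite S" "\<And>i. i \<in> S \<Longrightarrow> a i \<in> {-1, 1}"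
  shows "(\<Sum>x\<in>S \<rightarrow>\<^sub>E {-1, 1}. g (\<Sum>i\<in>S. a i * x i))
    = (\<Sum>k\<le>card S. real (card S choose k) * g (real (card S) - 2 * real k))"
  using assms
proof (induction S arbitrary: g rule: finite_induct)
  case empty
  then show ?case by simp
next
  case (insert i S)
  let ?P = "S \<rightarrow>\<^sub>E {-1, 1 :: real}"
  have upd: "(\<Sum>j\<in>insert i S. a j * (x(i := v)) j) = a i * v + (\<Sum>j\<in>S. a j * x j)" for x v
  proof -
    have "(\<Sum>j\<in>S. a j * (x(i := v)) j) = (\<Sum>j\<in>S. a j * x j)"
      using insert.hyps by (intro sum.cong) auto
    then show ?thesis using insert.hyps by simp
  qed
  have "(\<Sum>x\<in>insert i S \<rightarrow>\<^sub>E {-1, 1}. g (\<Sum>j\<in>insert i S. a j * x j))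
      = (\<Sum>(v, x)\<in>{-1, 1} \<times> ?P. g (\<Sum>j\<in>insert i S. a j * (x(i := v)) j))"
    unfolding PiE_insert_eq using inj_combinator[OF insert.hyps(2), of "\<lambda>_. {-1, 1 :: real}"]
    by (subst sum.reindex) (auto simp: split_def)
  also have "\<dots> = (\<Sum>v\<in>{-1, 1}. \<Sum>x\<in>?P. g (a i * v + (\<Sum>j\<in>S. a j * x j)))"
    unfolding upd by (rule sum.cartesian_product[symmetric])
  also have "\<dots> = (\<Sum>x\<in>?P. g ((\<Sum>j\<in>S. a j * x j) + 1) + g ((\<Sum>j\<in>S. a j * x j) - 1))"
    using insert.prems[of i] by (auto simp: sum.distrib add.commute)
  also have "\<dots> = (\<Sum>k\<le>card S. real (card S choose k)
      * (g (real (card S) - 2 * real k + 1) + g (real (card S) - 2 * real k - 1)))"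
    using insert.IH[of "\<lambda>t. g (t + 1) + g (t - 1)"] insert.prems by simp
  also have "\<dots> = (\<Sum>k\<le>card (insert i S). real (card (insert i S) choose k)
      * g (real (card (insert i S)) - 2 * real k))"
    unfolding card_insert_disjoint[OF insert.hyps] by (rule binomial_sum_Suc[symmetric])
  finally show ?case .
qed

text \<open>\<open>2 ^ n\<close> times the mean distance from the origin after \<open>n\<close> steps of the simple random walk.\<close>

definition abs_walk_sum :: "nat \<Rightarrow> real" where
  "abs_walk_sum n = (\<Sum>k\<le>n. real (n choose k) * \<bar>real n - 2 * real k\<bar>)"

text \<open>After an odd number of steps the walk is at an odd integer \<open>t\<close>, thus not at
  0, and there \<open>\<bar>t + 1\<bar> + \<bar>t - 1\<bar> = 2 * \<bar>t\<bar>\<close>.\<close>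

lemma abs_walk_sum_Suc_odd: "abs_walk_sum (2 * m + 2) = 2 * abs_walk_sum (2 * m + 1)"
proof -
  have "\<bar>t + 1\<bar> + \<bar>t - 1\<bar> = 2 * \<bar>t\<bar>" if "t = real (2 * m + 1) - 2 * real k" for t k
  proof -
    have "t = real_of_int (2 * (int m - int k) + 1)" using that by simp
    moreover have "2 * (int m - int k) + 1 \<ge> 1 \<or> 2 * (int m - int k) + 1 \<le> -1" by presburger
    ultimately have "t \<ge> 1 \<or> t \<le> -1" by linarith
    then show ?thesis by auto
  qed
  then show ?thesis
    using binomial_sum_Suc[of "2 * m + 1" abs]
    by (simp add: abs_walk_sum_def sum_distrib_left mult_ac)
qed

text \<open>After an even number of steps the mean distance grows only from the position 0, which is
  reached for \<open>k = m\<close>.\<close>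

lemma abs_walk_sum_Suc_even:
  "abs_walk_sum (2 * m + 1) = 2 * abs_walk_sum (2 * m) + 2 * real (2 * m choose m)"
proof -
  have step: "\<bar>t + 1\<bar> + \<bar>t - 1\<bar> = 2 * \<bar>t\<bar> + (if k = m then 2 else 0)"
    if "t = real (2 * m) - 2 * real k" for t k
  proof (cases "k = m")
    case False
    then have "k < m \<or> m < k" by arith
    then have "t \<ge> 1 \<or> t \<le> -1" using that by auto
    then show ?thesis using False by auto
  qed (use that in simp)
  have "abs_walk_sum (Suc (2 * m))
      = (\<Sum>k\<le>2 * m. real (2 * m choose k) * (2 * \<bar>real (2 * m) - 2 * real k\<bar> + (if k = m then 2 else 0)))"
    unfolding abs_walk_sum_def binomial_sum_Suc[of "2 * m" abs] using step by simp
  also have "\<dots> = 2 * abs_walk_sum (2 * m)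
      + (\<Sum>k\<le>2 * m. if k = m then 2 * real (2 * m choose m) else 0)"
    unfolding abs_walk_sum_def sum_distrib_left sum.distrib[symmetric]
    by (intro sum.cong) (auto simp: algebra_simps)
  finally show ?thesis by simp
qed

lemma central_binomial_Suc:
  "real (m + 1) * real (2 * m + 2 choose (m + 1)) = 2 * real (2 * m + 1) * real (2 * m choose m)"
proof -
  have "(2 * m + 1 choose m) = (2 * m + 1 choose (m + 1))"
    using binomial_symmetric[of m "2 * m + 1"] by simp
  then have "(m + 1) * (2 * m + 2 choose (m + 1)) = 2 * ((m + 1) * (2 * m + 1 choose (m + 1)))"
    using Suc_times_binomial[of m "2 * m + 1"] by (simp add: mult_ac)
  also have "(m + 1) * (2 * m + 1 choose (m + 1)) = (2 * m + 1) * (2 * m choose m)"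
    using Suc_times_binomial[of m "2 * m"] by simp
  finally show ?thesis
    by (metis of_nat_mult of_nat_numeral mult.assoc)
qed

lemma abs_walk_sum_odd: "abs_walk_sum (2 * m + 1) = 2 * real (2 * m + 1) * real (2 * m choose m)"
proof (induction m)
  case 0
  then show ?case by (simp add: abs_walk_sum_def)
next
  case (Suc m)
  have "abs_walk_sum (2 * Suc m + 1)
      = 4 * abs_walk_sum (2 * m + 1) + 2 * real (2 * m + 2 choose (m + 1))"
    using abs_walk_sum_Suc_even[of "Suc m"] abs_walk_sum_Suc_odd[of m] by simp
  also have "\<dots> = 4 * (2 * real (2 * m + 1) * real (2 * m choose m)) + 2 * real (2 * m + 2 choose (m + 1))"
    by (simp only: Suc.IH)
  \<comment> \<open>By the ratio of consecutive central binomial coefficients the first term is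
    \<open>4 * (m + 1)\<close> times the new one, and
    \<open>4 * (m + 1) + 2 = 2 * (2 * m + 3)\<close>.\<close>
  also have "\<dots> = 2 * real (2 * Suc m + 1) * real (2 * m + 2 choose (m + 1))"
    unfolding central_binomial_Suc[symmetric] by (simp add: algebra_simps)
  finally show ?case by simp
qed

text \<open>By the closed form this says that the mean distance after \<open>2 * m + 1\<close> steps
  is at least \<open>sqrt (m + 1)\<close>, squared so that the induction stays free of
  roots.\<close>

lemma central_binomial_lower: "16 ^ m * real (m + 1) \<le> (real (2 * m + 1) * real (2 * m choose m))\<^sup>2"
proof (induction m)
  case (Suc m)
  define B where "B = real (2 * m choose m)"
  define B' where "B' = real (2 * m + 2 choose (m + 1))"
  define M where "M = real m"
  have "real (m + 1) * B' = 2 * (real (2 * m + 1) * B)"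
    using central_binomial_Suc[of m] by (simp add: B_def B'_def)
  then have "(real (m + 1) * B')\<^sup>2 = 4 * (real (2 * m + 1) * B)\<^sup>2"
    by (simp add: power_mult_distrib)
  with Suc.IH[folded B_def] have *: "4 * (16 ^ m * (M + 1)) \<le> (M + 1)\<^sup>2 * B'\<^sup>2"
    unfolding power_mult_distrib by (simp add: M_def add.commute)
  have "(M + 1) * (4 * 16 ^ m) \<le> (M + 1) * ((M + 1) * B'\<^sup>2)"
    using * by (simp add: power2_eq_square mult_ac)
  then have le: "4 * 16 ^ m \<le> (M + 1) * B'\<^sup>2"
    by (simp add: M_def mult_le_cancel_left)
  have "16 ^ Suc m * (M + 2) = (4 * 16 ^ m) * (4 * (M + 2))" by simp
  also have "\<dots> \<le> ((M + 1) * B'\<^sup>2) * (4 * (M + 2))"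
    using le by (rule mult_right_mono) (simp add: M_def)
  also have "\<dots> = (4 * (M + 1) * (M + 2)) * B'\<^sup>2" by (simp add: algebra_simps)
  \<comment> \<open>The two sides differ by exactly \<open>B'\<^sup>2\<close>, as
    \<open>(2 * M + 3)\<^sup>2 = 4 * (M + 1) * (M + 2) + 1\<close>.\<close>
  also have "\<dots> \<le> (2 * M + 3)\<^sup>2 * B'\<^sup>2"
    by (rule mult_right_mono) (simp_all add: power2_eq_square algebra_simps M_def)
  finally have "16 ^ Suc m * (M + 2) \<le> ((2 * M + 3) * B')\<^sup>2" by (simp only: power_mult_distrib)
  moreover have "real (Suc m + 1) = M + 2" "real (2 * Suc m + 1) = 2 * M + 3"
    by (simp_all add: M_def)
  moreover have "real (2 * Suc m choose Suc m) = B'" by (simp add: B'_def)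
  ultimately show ?case by (simp only:)
qed simp

lemma abs_walk_sum_odd_lower: "2 ^ (2 * m + 1) * sqrt (real (m + 1)) \<le> abs_walk_sum (2 * m + 1)"
proof -
  have "sqrt (16 ^ m * real (m + 1)) \<le> real (2 * m + 1) * real (2 * m choose m)"
    using central_binomial_lower[of m] by (intro real_le_lsqrt) auto
  moreover have "sqrt (16 ^ m * real (m + 1)) = 4 ^ m * sqrt (real (m + 1))"
    by (simp add: real_sqrt_mult real_sqrt_power)
  moreover have "2 ^ (2 * m + 1) = 2 * (4 ^ m :: real)" by (simp add: power_mult)
  ultimately show ?thesis unfolding abs_walk_sum_odd by (simp only: mult.assoc)
qed

text \<open>For odd \<open>n = 2 * m + 1\<close> the bound \<open>sqrt (m + 1)\<close> exceeds
  \<open>sqrt (n / 2)\<close>. For \<open>n = 2 * m + 2\<close> the two agree, and the last step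
  only doubles the sum.\<close>

lemma abs_walk_sum_lower: "2 ^ n * sqrt (real n / 2) \<le> abs_walk_sum n"
proof -
  consider m where "n = 2 * m + 1" | m where "n = 2 * m + 2" | "n = 0"
    by (metis add_2_eq_Suc' evenE mult_Suc_right not0_implies_Suc oddE add.commute mult_0_right)
  then show ?thesis
  proof cases
    case (1 m)
    have "2 ^ n * sqrt (real n / 2) \<le> 2 ^ n * sqrt (real (m + 1))"
      by (intro mult_left_mono) (auto simp: 1)
    also have "\<dots> \<le> abs_walk_sum n" unfolding 1 by (rule abs_walk_sum_odd_lower)
    finally show ?thesis .
  next
    case (2 m)
    have "2 ^ n * sqrt (real n / 2) = 2 * (2 ^ (2 * m + 1) * sqrt (real (m + 1)))"
      by (simp add: 2 add_divide_distrib add.commute)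
    also have "\<dots> \<le> 2 * abs_walk_sum (2 * m + 1)"
      by (rule mult_left_mono[OF abs_walk_sum_odd_lower]) simp
    also have "\<dots> = abs_walk_sum n" unfolding 2 by (rule abs_walk_sum_Suc_odd[symmetric])
    finally show ?thesis .
  qed (simp add: abs_walk_sum_def)
qed

lemma card_sign_vectors: "card (sign_vectors n) = 2 ^ n"
  by (simp add: sign_vectors_def card_PiE numeral_2_eq_2)

lemma gale_berlekamp_lower: "real n * sqrt (real n / 2) \<le> gale_berlekamp n"
proof (rule le_gale_berlekamp, rule ccontr)
  fix a assume a: "a \<in> sign_matrices n"
  let ?V = "sign_vectors n" and ?c = "real n * sqrt (real n / 2)"
  let ?S = "\<lambda>y. \<Sum>i=1..n. \<bar>\<Sum>j=1..n. a i j * y j\<bar>"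
  assume "\<not> (\<exists>y\<in>?V. ?c \<le> ?S y)"
  then have "?S y < ?c" if "y \<in> ?V" for y using that by force
  moreover have "?V \<noteq> {}" using restrict_sign_vectors[of n "\<lambda>_. 1"] by auto
  ultimately have "(\<Sum>y\<in>?V. ?S y) < (\<Sum>y\<in>?V. ?c)" by (intro sum_strict_mono) auto
  also have "\<dots> = real n * (2 ^ n * sqrt (real n / 2))" by (simp add: card_sign_vectors)
  also have "\<dots> \<le> real n * abs_walk_sum n"
    using abs_walk_sum_lower by (rule mult_left_mono) simp
  \<comment> \<open>Summed over all \<open>y\<close>, each row gives the same amount whatever its
    signs, so the total over \<open>y\<close> contradicts the strict bound for every single
    \<open>y\<close>.\<close>
  also have "\<dots> = (\<Sum>i=1..n. \<Sum>y\<in>?V. \<bar>\<Sum>j=1..n. a i j * y j\<bar>)"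
  proof -
    have "(\<Sum>y\<in>?V. \<bar>\<Sum>j=1..n. a i j * y j\<bar>) = abs_walk_sum n" if "i \<in> {1..n}" for i
      using sum_signs[of "{1..n}" "a i" abs] sign_vectors_nth[OF sign_matrices_nth[OF a that]]
      by (simp add: abs_walk_sum_def sign_vectors_def)
    then show ?thesis by simp
  qed
  also have "\<dots> = (\<Sum>y\<in>?V. ?S y)" by (rule sum.swap)
  finally show False by simp
qed

section \<open>The upper bound\<close>

text \<open>Restoring the omitted \<open>N - n\<close> rows only increases the sum of squares. Over
  all \<open>N\<close> rows the \<open>n\<close> columns are orthogonal, so the mixed terms vanish
  and \<open>n * N\<close> remains.\<close>

lemma hadamard_parseval:
  assumes "hadamard_order N" "n \<le> N"
  shows "\<exists>a\<in>sign_matrices n. \<forall>y\<in>sign_vectors n.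
    (\<Sum>i=1..n. (\<Sum>j=1..n. a i j * y j)\<^sup>2) \<le> real n * real N"
proof -
  obtain H :: "nat \<Rightarrow> nat \<Rightarrow> int"
    where sign: "\<And>i j. i < N \<Longrightarrow> j < N \<Longrightarrow> H i j \<in> {-1, 1}"
      and orth: "\<And>i k. i < N \<Longrightarrow> k < N \<Longrightarrow> i \<noteq> k \<Longrightarrow> (\<Sum>j<N. H i j * H k j) = 0"
    using assms unfolding hadamard_order_def by blast
  \<comment> \<open>Transposed, because \<open>hadamard_order\<close> supplies orthogonal rows while
    orthogonal columns are wanted; the shift passes from indices starting at 1 to indices starting
    at 0.\<close>
  define b where "b i j = real_of_int (H (j - 1) (i - 1))" for i j
  define a where "a = (\<lambda>i\<in>{1..n}. \<lambda>j\<in>{1..n}. b i j)"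
  have b_sign: "b i j \<in> {-1, 1}" if "i \<in> {1..N}" "j \<in> {1..n}" for i j
    using sign[of "j - 1" "i - 1"] that assms(2) by (auto simp: b_def)
  have b_orth: "(\<Sum>i=1..N. b i j * b i k) = (if j = k then real N else 0)"
    if jk: "j \<in> {1..n}" "k \<in> {1..n}" for j k
  proof (cases "j = k")
    case True
    have "b i j * b i k = 1" if "i \<in> {1..N}" for i
      using b_sign[OF that jk(1)] by (auto simp: True)
    then show ?thesis using True by simp
  next
    case False
    have "(\<Sum>i=1..N. b i j * b i k) = (\<Sum>i<N. real_of_int (H (j - 1) i * H (k - 1) i))"
      unfolding b_def by (rule sum.reindex_bij_witness[of _ Suc "\<lambda>i. i - 1"]) auto
    also have "\<dots> = real_of_int (\<Sum>i<N. H (j - 1) i * H (k - 1) i)" by simp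
    also have "(\<Sum>i<N. H (j - 1) i * H (k - 1) i) = 0"
      using jk False assms(2) by (intro orth) auto
    finally show ?thesis using False by simp
  qed
  have "(\<Sum>i=1..n. (\<Sum>j=1..n. a i j * y j)\<^sup>2) \<le> real n * real N" if y: "y \<in> sign_vectors n" for y
  proof -
    have "(\<Sum>i=1..n. (\<Sum>j=1..n. a i j * y j)\<^sup>2) = (\<Sum>i=1..n. (\<Sum>j=1..n. b i j * y j)\<^sup>2)"
      by (simp add: a_def)
    also have "\<dots> \<le> (\<Sum>i=1..N. (\<Sum>j=1..n. b i j * y j)\<^sup>2)"
      using assms(2) by (intro sum_mono2) auto
    also have "\<dots> = (\<Sum>i=1..N. \<Sum>j=1..n. \<Sum>k=1..n. y j * y k * (b i j * b i k))"
      by (simp add: power2_eq_square sum_product mult_ac)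
    also have "\<dots> = (\<Sum>j=1..n. \<Sum>i=1..N. \<Sum>k=1..n. y j * y k * (b i j * b i k))"
      by (rule sum.swap)
    also have "\<dots> = (\<Sum>j=1..n. \<Sum>k=1..n. y j * y k * (\<Sum>i=1..N. b i j * b i k))"
      unfolding sum_distrib_left by (intro sum.cong refl sum.swap)
    also have "\<dots> = (\<Sum>j=1..n. \<Sum>k=1..n. if j = k then y j * y k * real N else 0)"
      by (intro sum.cong refl, simp only: b_orth) simp
    also have "\<dots> = (\<Sum>j=1..n. y j * y j * real N)" by simp
    also have "\<dots> = (\<Sum>j=1..n. real N)"
      using sign_vectors_nth[OF y] by (intro sum.cong refl) force
    finally show ?thesis by simp
  qed
  moreover have "a \<in> sign_matrices n"
    unfolding a_def using b_sign assms(2) by (intro restrict_sign_matrices) auto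
  ultimately show ?thesis by blast
qed

text \<open>This is Cauchy-Schwarz, carried out with the tangent
  \<open>2 * s * t \<le> t\<^sup>2 + s\<^sup>2\<close> at \<open>s = sqrt N\<close>. The case
  \<open>N = 0\<close> is separate because \<open>s\<close> is cancelled at the end.\<close>

lemma gale_berlekamp_le_hadamard:
  assumes "hadamard_order N" "n \<le> N"
  shows "gale_berlekamp n \<le> real n * sqrt (real N)"
proof (cases "N = 0")
  case True
  obtain a where "a \<in> sign_matrices n" using hadamard_parseval[OF assms] by blast
  then show ?thesis by (rule gale_berlekamp_le) (use True assms in simp)
next
  case False
  obtain a where a: "a \<in> sign_matrices n"
    and sq: "\<And>y. y \<in> sign_vectors n \<Longrightarrow>
      (\<Sum>i=1..n. (\<Sum>j=1..n. a i j * y j)\<^sup>2) \<le> real n * real N"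
    using hadamard_parseval[OF assms] by blast
  show ?thesis
  proof (rule gale_berlekamp_le[OF a])
    fix y assume y: "y \<in> sign_vectors n"
    define t where "t i = \<bar>\<Sum>j=1..n. a i j * y j\<bar>" for i
    define s where "s = sqrt (real N)"
    have s: "s > 0" "s\<^sup>2 = real N" using False by (simp_all add: s_def)
    have "2 * s * t i \<le> (t i)\<^sup>2 + s\<^sup>2" for i
      using sum_squares_bound[of s "t i"] by (simp add: add.commute)
    then have "(\<Sum>i=1..n. 2 * s * t i) \<le> (\<Sum>i=1..n. (t i)\<^sup>2 + s\<^sup>2)" by (intro sum_mono)
    also have "\<dots> = (\<Sum>i=1..n. (t i)\<^sup>2) + real n * s\<^sup>2" by (simp add: sum.distrib)
    also have "\<dots> \<le> 2 * s * (real n * s)"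
      using sq[OF y] by (simp add: t_def s(2)[symmetric] power2_eq_square mult_ac)
    finally have "2 * s * (\<Sum>i=1..n. t i) \<le> 2 * s * (real n * s)" by (simp add: sum_distrib_left)
    then show "(\<Sum>i=1..n. \<bar>\<Sum>j=1..n. a i j * y j\<bar>) \<le> real n * sqrt (real N)"
      using s(1) by (simp add: t_def s_def)
  qed
qed

lemma sum_signs_parity:
  fixes u :: "'a \<Rightarrow> real"
  assumes "finite S" "\<And>i. i \<in> S \<Longrightarrow> u i \<in> {-1, 1}"
  obtains m :: int where "sum u S = real_of_int (int (card S) - 2 * m)"
proof -
  have "\<exists>m::int. sum u S = real_of_int (int (card S) - 2 * m)"
    using assms
  proof (induction S rule: finite_induct)
    case (insert i S)
    then obtain m :: int where m: "sum u S = real_of_int (int (card S) - 2 * m)" by auto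
    have "u i = 1 \<or> u i = -1" using insert.prems[of i] by auto
    then show ?case
    proof
      assume "u i = 1"
      then show ?thesis using m insert.hyps by (intro exI[of _ m]) simp
    next
      assume "u i = -1"
      then show ?thesis using m insert.hyps by (intro exI[of _ "m + 1"]) simp
    qed
  qed simp
  then show thesis using that by blast
qed

text \<open>The row sums \<open>t\<close> all have the parity of \<open>n\<close>, hence that of \<open>l\<close>, so that
  \<open>(t - l) * (t - l - 2) \<ge> 0\<close>. This replaces the tangent line of \<open>t\<^sup>2\<close> by a chord.\<close>

lemma gale_berlekamp_le_hadamard_parity:
  assumes "hadamard_order N" "n \<le> N" "even (n + l)"
  shows "gale_berlekamp n \<le> real_of_int (int (n * (N + l * (l + 2))) div int (2 * (l + 1)))"
proof -
  obtain a where a: "a \<in> sign_matrices n"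
    and sq: "\<And>y. y \<in> sign_vectors n \<Longrightarrow>
      (\<Sum>i=1..n. (\<Sum>j=1..n. a i j * y j)\<^sup>2) \<le> real n * real N"
    using hadamard_parseval[OF assms(1,2)] by blast
  show ?thesis
  proof (rule gale_berlekamp_le[OF a])
    fix y assume y: "y \<in> sign_vectors n"
    have "\<exists>m::int. (\<Sum>j=1..n. a i j * y j) = real_of_int (int n - 2 * m)" if i: "i \<in> {1..n}" for i
    proof -
      have "a i j * y j \<in> {-1, 1}" if "j \<in> {1..n}" for j
        using sign_vectors_nth[OF sign_matrices_nth[OF a i] that] sign_vectors_nth[OF y that] by auto
      then show ?thesis using sum_signs_parity[of "{1..n}" "\<lambda>j. a i j * y j"] by fastforce
    qed
    then obtain m :: "nat \<Rightarrow> int"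
      where m: "\<And>i. i \<in> {1..n} \<Longrightarrow> (\<Sum>j=1..n. a i j * y j) = real_of_int (int n - 2 * m i)"
      by metis
    define t where "t i = \<bar>int n - 2 * m i\<bar>" for i
    have "real_of_int (\<Sum>i=1..n. (t i)\<^sup>2) = (\<Sum>i=1..n. (\<Sum>j=1..n. a i j * y j)\<^sup>2)"
      unfolding of_int_sum by (intro sum.cong refl, simp only: m t_def) simp
    also have "\<dots> \<le> real_of_int (int n * int N)" using sq[OF y] by simp
    finally have sq_t: "(\<Sum>i=1..n. (t i)\<^sup>2) \<le> int n * int N" by (simp only: of_int_le_iff)
    have chord: "2 * (int l + 1) * t i \<le> (t i)\<^sup>2 + int l * (int l + 2)" for i
    proof -
      have "even (t i - int l)" using assms(3) by (simp add: t_def)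
      then obtain q where q: "t i = int l + 2 * q" by (metis add.commute diff_add_cancel evenE)
      \<comment> \<open>With \<open>t i = l + 2 * q\<close> the gap in the chord inequality is
        \<open>4 * q * (q - 1)\<close>, a multiple of a product of consecutive integers.\<close>
      have "0 \<le> q * (q - 1)" by (cases "q \<ge> 1") (auto simp: mult_nonpos_nonpos)
      then show ?thesis by (simp add: q power2_eq_square algebra_simps)
    qed
    have "(\<Sum>i=1..n. 2 * (int l + 1) * t i) \<le> (\<Sum>i=1..n. (t i)\<^sup>2 + int l * (int l + 2))"
      by (intro sum_mono chord)
    also have "\<dots> = (\<Sum>i=1..n. (t i)\<^sup>2) + int n * (int l * (int l + 2))"
      by (simp add: sum.distrib)
    also have "\<dots> \<le> int n * int N + int n * (int l * (int l + 2))" using sq_t by simp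
    finally have "2 * (int l + 1) * (\<Sum>i=1..n. t i) \<le> int n * int N + int n * (int l * (int l + 2))"
      unfolding sum_distrib_left .
    then have "(\<Sum>i=1..n. t i) * int (2 * (l + 1)) \<le> int (n * (N + l * (l + 2)))"
      by (simp add: algebra_simps)
    \<comment> \<open>The sum of the \<open>t i\<close> is an integer, so the quotient may be
      rounded down.\<close>
    then have "((\<Sum>i=1..n. t i) * int (2 * (l + 1))) div int (2 * (l + 1))
        \<le> int (n * (N + l * (l + 2))) div int (2 * (l + 1))"
      by (rule zdiv_mono1) simp
    then have "(\<Sum>i=1..n. t i) \<le> int (n * (N + l * (l + 2))) div int (2 * (l + 1))"
      by (subst (asm) nonzero_mult_div_cancel_right) simp_all
    then have "real_of_int (\<Sum>i=1..n. t i) \<le> real_of_int (int (n * (N + l * (l + 2))) div int (2 * (l + 1)))"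
      by (simp only: of_int_le_iff)
    moreover have "(\<Sum>i=1..n. \<bar>\<Sum>j=1..n. a i j * y j\<bar>) = real_of_int (\<Sum>i=1..n. t i)"
      unfolding of_int_sum by (intro sum.cong refl) (simp only: m t_def of_int_abs)
    ultimately show "(\<Sum>i=1..n. \<bar>\<Sum>j=1..n. a i j * y j\<bar>)
        \<le> real_of_int (int (n * (N + l * (l + 2))) div int (2 * (l + 1)))"
      by simp
  qed
qed

text \<open>Here \<open>v\<close> lists the row sums over the columns whose signs are already chosen, and the
  remaining columns are branched over.\<close>

fun row_sums_bounded :: "int \<Rightarrow> int list \<Rightarrow> int list list \<Rightarrow> bool" where
  "row_sums_bounded b v [] \<longleftrightarrow> sum_list (map abs v) \<le> b"
| "row_sums_bounded b v (c # cs) \<longleftrightarrow>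
     row_sums_bounded b (map2 (+) v c) cs \<and> row_sums_bounded b (map2 (-) v c) cs"

text \<open>The sign of the first remaining column selects the branch, which absorbs that column
  into \<open>v\<close>. The columns need the length of \<open>v\<close> since \<open>map2\<close>
  truncates.\<close>

lemma row_sums_boundedD:
  fixes y :: "nat \<Rightarrow> real"
  assumes "row_sums_bounded b v cs" "\<And>c. c \<in> set cs \<Longrightarrow> length c = length v"
    "\<And>j. j < length cs \<Longrightarrow> y j \<in> {-1, 1}"
  shows "(\<Sum>i<length v. \<bar>of_int (v ! i) + (\<Sum>j<length cs. of_int (cs ! j ! i) * y j)\<bar>) \<le> of_int b"
  using assms
proof (induction cs arbitrary: v y)
  case Nil
  then have "real_of_int (\<Sum>i<length v. \<bar>v ! i\<bar>) \<le> of_int b"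
    unfolding of_int_le_iff by (simp add: sum_list_sum_nth lessThan_atLeast0)
  then show ?case by simp
next
  case (Cons c cs)
  have len: "length c = length v" using Cons.prems(2) by simp
  have step: "(\<Sum>i<length v. \<bar>of_int (w ! i)
      + (\<Sum>j<length cs. of_int (cs ! j ! i) * y (Suc j))\<bar>) \<le> of_int b"
    if "row_sums_bounded b w cs" "length w = length v" for w
    using Cons.IH[of w "\<lambda>j. y (Suc j)"] Cons.prems(2,3) that by simp
  have "y 0 = 1 \<or> y 0 = -1" using Cons.prems(3)[of 0] by auto
  then show ?case
  proof
    assume "y 0 = 1"
    then show ?thesis
      using step[of "map2 (+) v c"] Cons.prems(1) len
      by (simp add: sum.lessThan_Suc_shift add.assoc del: sum.lessThan_Suc)
  next
    assume "y 0 = -1"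
    then show ?thesis
      using step[of "map2 (-) v c"] Cons.prems(1) len
      by (simp add: sum.lessThan_Suc_shift diff_add_eq add_diff_eq del: sum.lessThan_Suc)
  qed
qed

lemma gale_berlekamp_le_checked:
  assumes "row_sums_bounded b (replicate n 0) cs" "length cs = n"
    "list_all (\<lambda>c. length c = n \<and> list_all (\<lambda>x. x = 1 \<or> x = -1) c) cs"
  shows "gale_berlekamp n \<le> of_int b"
proof (rule gale_berlekamp_le)
  \<comment> \<open>The list \<open>cs\<close> holds columns, hence the swapped indices.\<close>
  let ?a = "\<lambda>i\<in>{1..n}. \<lambda>j\<in>{1..n}. real_of_int (cs ! (j - 1) ! (i - 1))"
  have "real_of_int (cs ! (j - 1) ! (i - 1)) \<in> {-1, 1}" if "i \<in> {1..n}" "j \<in> {1..n}" for i j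
  proof -
    have "cs ! (j - 1) \<in> set cs" using assms(2) that by (intro nth_mem) auto
    then have c: "length (cs ! (j - 1)) = n" "list_all (\<lambda>x. x = 1 \<or> x = -1) (cs ! (j - 1))"
      using assms(3) by (simp_all add: list_all_iff)
    have "cs ! (j - 1) ! (i - 1) \<in> set (cs ! (j - 1))" using c(1) that by (intro nth_mem) auto
    then show ?thesis using c(2) by (auto simp: list_all_iff)
  qed
  then show "?a \<in> sign_matrices n" by (rule restrict_sign_matrices)
  fix y assume y: "y \<in> sign_vectors n"
  have "(\<Sum>i=1..n. \<bar>\<Sum>j=1..n. ?a i j * y j\<bar>)
      = (\<Sum>i<n. \<bar>\<Sum>j<n. real_of_int (cs ! j ! i) * y (Suc j)\<bar>)"
    unfolding One_nat_def sum.atLeast1_atMost_eq by simp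
  also have "\<dots> \<le> of_int b"
    using row_sums_boundedD[OF assms(1), of "\<lambda>j. y (Suc j)"] assms(2,3) sign_vectors_nth[OF y]
    by (simp add: list_all_iff)
  finally show "(\<Sum>i=1..n. \<bar>\<Sum>j=1..n. ?a i j * y j\<bar>) \<le> of_int b" .
qed

text \<open>For \<open>n = 5, 6, 9\<close> submatrices of Hadamard matrices do not give a good enough bound; the
  matrices below come from a computer search.\<close>

lemma gale_berlekamp_5: "gale_berlekamp 5 \<le> 11"
proof -
  have "gale_berlekamp 5 \<le> of_int 11"
    by (rule gale_berlekamp_le_checked[where cs = "
    [[-1, -1, 1, -1, -1],
     [1, 1, 1, 1, -1],
     [-1, 1, -1, -1, -1],
     [-1, -1, -1, 1, 1],
     [1, 1, -1, -1, 1]]"]) code_simp+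
  then show ?thesis by simp
qed

lemma gale_berlekamp_6: "gale_berlekamp 6 \<le> 14"
proof -
  have "gale_berlekamp 6 \<le> of_int 14"
    by (rule gale_berlekamp_le_checked[where cs = "
    [[1, -1, -1, 1, -1, -1],
     [-1, -1, -1, -1, 1, -1],
     [1, 1, 1, 1, 1, -1],
     [1, 1, 1, -1, -1, -1],
     [-1, 1, -1, 1, 1, -1],
     [-1, 1, -1, 1, -1, 1]]"]) code_simp+
  then show ?thesis by simp
qed

lemma gale_berlekamp_9: "gale_berlekamp 9 \<le> 27"
proof -
  have "gale_berlekamp 9 \<le> of_int 27"
    by (rule gale_berlekamp_le_checked[where cs = "
    [[-1, 1, 1, -1, -1, 1, 1, 1, 1],
     [1, 1, -1, -1, -1, -1, 1, -1, -1],
     [-1, -1, 1, -1, 1, -1, 1, 1, -1],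
     [-1, -1, -1, 1, -1, -1, 1, 1, -1],
     [-1, 1, 1, 1, 1, 1, 1, -1, -1],
     [1, -1, -1, -1, 1, 1, 1, 1, 1],
     [-1, 1, -1, -1, 1, -1, 1, -1, 1],
     [1, 1, 1, 1, -1, -1, 1, 1, 1],
     [-1, -1, 1, -1, -1, -1, -1, -1, 1]]"]) code_simp+
  then show ?thesis by simp
qed

section \<open>The numerical constant and the choice of orders\<close>

text \<open>Squaring removes both roots: the square of the constant is \<open>5625 / 4913\<close>,
  that is \<open>75\<^sup>2 / 17 ^ 3\<close>.\<close>

lemma gale_berlekamp_ratio_le:
  assumes "n \<ge> 1" "gale_berlekamp n \<le> s" "4913 * s\<^sup>2 \<le> 5625 * real n ^ 3"
  shows "gale_berlekamp n / real n powr (3 / 2) \<le> 75 * sqrt 17 / 289"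
proof -
  let ?c = "75 * sqrt 17 / 289" and ?r = "real n powr (3 / 2)"
  have "?r\<^sup>2 = real n powr 3" by (simp add: power2_eq_square powr_add[symmetric])
  then have r: "?r > 0" "?r\<^sup>2 = real n ^ 3" using assms(1) by simp_all
  have c: "?c\<^sup>2 = 5625 / 4913" by (simp add: power_divide power_mult_distrib)
  have "(?c * ?r)\<^sup>2 = 5625 / 4913 * real n ^ 3" by (simp only: power_mult_distrib r(2) c)
  then have "s\<^sup>2 \<le> (?c * ?r)\<^sup>2" using assms(3) by simp
  then have "s \<le> ?c * ?r" by (rule power2_le_imp_le) simp
  then show ?thesis using assms(2) r(1) by (simp add: pos_divide_le_eq)
qed

lemma ratio_le_hadamard:
  assumes "n \<ge> 1" "hadamard_order N" "n \<le> N" "4913 * N \<le> 5625 * n"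
  shows "gale_berlekamp n / real n powr (3 / 2) \<le> 75 * sqrt 17 / 289"
proof (rule gale_berlekamp_ratio_le[OF assms(1) gale_berlekamp_le_hadamard[OF assms(2,3)]])
  have "real (4913 * N) * (real n)\<^sup>2 \<le> real (5625 * n) * (real n)\<^sup>2"
    using assms(4) by (intro mult_right_mono of_nat_mono) auto
  then show "4913 * (real n * sqrt (real N))\<^sup>2 \<le> 5625 * real n ^ 3"
    by (simp add: power_mult_distrib power2_eq_square power3_eq_cube mult_ac)
qed

lemma ratio_le_small:
  assumes "1 \<le> n" "n < 64"
  shows "gale_berlekamp n / real n powr (3 / 2) \<le> 75 * sqrt 17 / 289"
proof -
  let ?orders = "[1, 2, 4, 8, 12, 16, 20, 24, 28, 32, 36, 40, 44, 48, 56, 64]"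
  have "list_all hadamard_order ?orders"
    using hadamard_orders[of 0] hadamard_orders[of 1] hadamard_orders[of 2] hadamard_orders(7)[of 3]
      hadamard_orders(7)[of 4] hadamard_orders(7)[of 5] hadamard_orders(7)[of 6]
    by simp
  then have orders: "hadamard_order N" if "N \<in> set ?orders" for N
    using that unfolding list_all_iff by blast
  \<comment> \<open>For the seven exceptions no listed order lies between \<open>n\<close> and
    \<open>5625 / 4913 * n\<close>.\<close>
  have "list_all (\<lambda>n. n \<in> set [3, 5, 6, 9, 10, 13, 17]
      \<or> list_ex (\<lambda>N. n \<le> N \<and> 4913 * N \<le> 5625 * n) ?orders) (1 # [2..<64])"
    by simp
  moreover have "n \<in> set (1 # [2..<64])" using assms unfolding list.set set_upt by auto
  ultimately have "n \<in> set [3, 5, 6, 9, 10, 13, 17]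
      \<or> list_ex (\<lambda>N. n \<le> N \<and> 4913 * N \<le> 5625 * n) ?orders"
    unfolding list_all_iff by blast
  then consider "n = 3" | "n = 5" | "n = 6" | "n = 9" | "n = 10" | "n = 13" | "n = 17"
    | N where "N \<in> set ?orders" "n \<le> N" "4913 * N \<le> 5625 * n"
    unfolding list_ex_iff by (elim disjE) (force, blast)
  then show ?thesis
  proof cases
    \<comment> \<open>For 3, 10, 13, 17 the chord is chosen with
      \<open>l \<le> sqrt N \<le> l + 2\<close>. The bounds are 21/4, 200/6, 403/8 and 595/8 rounded
      down; for 13 the rounding is essential.\<close>
    case 1
    then show ?thesis
      using gale_berlekamp_le_hadamard_parity[OF orders[of 4], of 3 1]
      by (intro gale_berlekamp_ratio_le[of n "5"]) simp_all
  next
    case 2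
    then show ?thesis using gale_berlekamp_5 by (intro gale_berlekamp_ratio_le[of n 11]) simp_all
  next
    case 3
    then show ?thesis using gale_berlekamp_6 by (intro gale_berlekamp_ratio_le[of n 14]) simp_all
  next
    case 4
    then show ?thesis using gale_berlekamp_9 by (intro gale_berlekamp_ratio_le[of n 27]) simp_all
  next
    case 5
    then show ?thesis
      using gale_berlekamp_le_hadamard_parity[OF orders[of 12], of 10 2]
      by (intro gale_berlekamp_ratio_le[of n 33]) simp_all
  next
    case 6
    then show ?thesis
      using gale_berlekamp_le_hadamard_parity[OF orders[of 16], of 13 3]
      by (intro gale_berlekamp_ratio_le[of n 50]) simp_all
  next
    case 7
    then show ?thesis
      using gale_berlekamp_le_hadamard_parity[OF orders[of 20], of 17 3]
      by (intro gale_berlekamp_ratio_le[of n 74]) simp_all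
  next
    case (8 N)
    then show ?thesis using ratio_le_hadamard[OF assms(1) orders] by blast
  qed
qed

text \<open>Scaling by a power of two reduces the claim to the block from 64 to 128. There the
  successive orders 72, 80, 88, 96, 104, 112, 128 have ratios of at most 8/7, attained at the end,
  and 8/7 is just below 5625/4913.\<close>

lemma ratio_le_large:
  assumes "64 \<le> n"
  shows "gale_berlekamp n / real n powr (3 / 2) \<le> 75 * sqrt 17 / 289"
proof -
  have "1 \<le> n div 64" using assms by simp
  then obtain k where k: "2 ^ k \<le> n div 64" "n div 64 < 2 ^ (k + 1)"
    using ex_power_ivl1[of 2 "n div 64"] by auto
  define q :: nat where "q = 2 ^ k"
  have n: "64 * q \<le> n" "n < 128 * q" using k by (auto simp: q_def)
  \<comment> \<open>The factors are 72 = 2 * 36, 80 = 4 * 20, 88 = 2 * 44, 96 = 8 * 12, 112 = 4 * 28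
    and 128 = 2^7. The order 104 splits the step from 96 to 112, whose ratio 7/6 would be too
    large.\<close>
  have orders: "hadamard_order (c * q)" if "c \<in> {72, 80, 88, 96, 104, 112, 128}" for c
    using that hadamard_orders(1)[of "k + 3"] hadamard_orders(2)[of "k + 2"] hadamard_orders(3)[of "k + 2"]
      hadamard_orders(4)[of "k + 1"] hadamard_orders(5)[of "k + 1"] hadamard_orders(6)[of k]
      hadamard_orders(7)[of "k + 7"]
    by (auto simp: q_def power_add mult.commute)
  define c :: nat where "c = (if n \<le> 72 * q then 72 else if n \<le> 80 * q then 80
    else if n \<le> 88 * q then 88 else if n \<le> 96 * q then 96 else if n \<le> 104 * q then 104
    else if n \<le> 112 * q then 112 else 128)"
  have "hadamard_order (c * q)" by (rule orders) (simp add: c_def)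
  moreover have "n \<le> c * q" "4913 * (c * q) \<le> 5625 * n"
    using n by (auto simp: c_def)
  ultimately show ?thesis using ratio_le_hadamard[of n "c * q"] assms by simp
qed

theorem theorem5p2:
  fixes n :: nat
  assumes "n \<ge> 1"
  shows "1 / sqrt 2 \<le> gale_berlekamp n / real n powr (3 / 2) \<and>
         gale_berlekamp n / real n powr (3 / 2) \<le> 75 * sqrt 17 / 289"
proof
  have "real n powr (3 / 2) = real n powr (1 + 1 / 2)" by simp
  also have "\<dots> = real n * sqrt (real n)"
    using assms unfolding powr_add by (simp add: powr_half_sqrt)
  finally have "real n powr (3 / 2) = real n * sqrt (real n)" .
  then have "1 / sqrt 2 * real n powr (3 / 2) \<le> gale_berlekamp n"
    using gale_berlekamp_lower[of n] by (simp add: real_sqrt_divide)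
  then show "1 / sqrt 2 \<le> gale_berlekamp n / real n powr (3 / 2)"
    using assms by (simp add: pos_le_divide_eq)
  show "gale_berlekamp n / real n powr (3 / 2) \<le> 75 * sqrt 17 / 289"
    using assms ratio_le_small ratio_le_large by (cases "n < 64") auto
qed

end
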